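(* Let $(F_t)_{t\in[0,1]}$ be an isotopy in $\mathrm{Diff}^1(\mathbb{R}^2)$ joining $\mathrm{Id}_{\mathbb{R}^2}$ to $F_1=F$. Assume that there exist two points $x,y\in\mathbb{R}^2$, $x\neq y$, such that $\mathrm{Linking}_1((F_t)_t,x,y)=l\in\mathbb{R}$. Then there exists a point $z$ in the segment $[x,y]$ such that $\mathrm{Torsion}_1((F_t)_t,z,y-x)=l$.
   Context: $\mathbb{R}^2$ carries the Euclidean metric, the standard trivialization and the counterclockwise orientation; $\mathbb{T}=\mathbb{R}/2\pi\mathbb{Z}$. An isotopy joining $\mathrm{Id}$ to $F$ is a path $(F_t)_{t\in[0,1]}$ in $\mathrm{Diff}^1(\mathbb{R}^2)$, continuous for the weak (compact-open) $C^1$ topology, with $F_0=\mathrm{Id}$ and $F_1=F$. For non-zero vectors $u,v$, $\theta(u,v)\in\mathbb{T}$ is the oriented angle from $u$ to $v$. A continuous determination of a continuous function $I\to\mathbb{T}$ ($I\subseteq\mathbb{R}$ an interval) is a continuous lift $I\to\mathbb{R}$. $\mathrm{Torsion}_1((F_t)_t,z,\xi)$, for $z\in\mathbb{R}^2$ and $\xi\in\mathbb{R}^2\setminus\{0\}$, is $\tilde v(1)-\tilde v(0)$, where $\tilde v$ is any continuous determination of $t\mapsto\theta((1,0),DF_t(z)\xi)$, $t\in[0,1]$. $\mathrm{Linking}_1((F_t)_t,x,y)$, for $x\ne y$, is $\tilde u(1)-\tilde u(0)$, where $\tilde u$ is any continuous determination of $t\mapsto\theta((1,0),F_t(y)-F_t(x))$,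 $t\in[0,1]$. $[x,y]=\{sy+(1-s)x: s\in[0,1]\}$. *)

theory Defs
  imports "HOL-Analysis.Analysis"
begin

type_synonym plane = "real ^ 2"

subsection \<open>\<open>Diff\<^sup>1(\<real>\<^sup>2)\<close> with the weak \<open>C\<^sup>1\<close> topology, and isotopies\<close>

definition C1_map :: "(plane \<Rightarrow> plane) \<Rightarrow> bool" where
  "C1_map f \<longleftrightarrow> (\<forall>z. f differentiable (at z)) \<and> continuous_on UNIV (\<lambda>z. jacobian f (at z))"

definition Diff1 :: "(plane \<Rightarrow> plane) set" where
  "Diff1 = {f. bij f \<and> C1_map f \<and> C1_map (inv f)}"

definition C1_nbhd :: "(plane \<Rightarrow> plane) \<Rightarrow> plane set \<Rightarrow> real \<Rightarrow> (plane \<Rightarrow> plane) set" where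
  "C1_nbhd f K e = {g \<in> Diff1. \<forall>z\<in>K. dist (g z) (f z) < e \<and>
                                    dist (jacobian g (at z)) (jacobian f (at z)) < e}"

text \<open>The sets \<^const>\<open>C1_nbhd\<close> form the usual subbase of the weak (compact-open) \<open>C\<^sup>1\<close> topology,
  i.e. that of locally uniform convergence of maps together with their first derivatives.\<close>

definition weak_C1_topology :: "(plane \<Rightarrow> plane) topology" where
  "weak_C1_topology =
     topology_generated_by {C1_nbhd f K e | f K e. f \<in> Diff1 \<and> compact K \<and> e > 0}"

lemma topspace_weak_C1_topology: "topspace weak_C1_topology = Diff1"
proof -
  have "Diff1 \<subseteq> \<Union>{C1_nbhd f K e | f K e. f \<in> Diff1 \<and> compact K \<and> e > 0}"
  proof
    fix f assume "f \<in> Diff1"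
    then show "f \<in> \<Union>{C1_nbhd f K e | f K e. f \<in> Diff1 \<and> compact K \<and> e > 0}"
      by (intro UnionI[of "C1_nbhd f {} 1"] CollectI exI[of _ f] exI[of _ "{}"] exI[of _ 1])
         (simp_all add: C1_nbhd_def)
  qed
  then show ?thesis
    by (auto simp: weak_C1_topology_def topology_generated_by_topspace C1_nbhd_def)
qed

text \<open>Only the values \<open>F t\<close> with \<open>t \<in> {0..1}\<close> are relevant in \<^const>\<open>pathin\<close>, which also
  forces them to lie in \<^const>\<open>Diff1\<close>.\<close>

definition isotopy_joining ::
  "(real \<Rightarrow> plane \<Rightarrow> plane) \<Rightarrow> (plane \<Rightarrow> plane) \<Rightarrow> (plane \<Rightarrow> plane) \<Rightarrow> bool" where
  "isotopy_joining F f g \<longleftrightarrow> pathin weak_C1_topology F \<and> F 0 = f \<and> F 1 = g"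

subsection \<open>The circle \<open>\<real>/2\<pi>\<int>\<close>, oriented angles and continuous determinations\<close>

definition cong_2pi :: "real \<Rightarrow> real \<Rightarrow> bool" where
  "cong_2pi a b \<longleftrightarrow> (\<exists>k::int. b = a + 2 * pi * of_int k)"

lemma equivp_cong_2pi: "equivp cong_2pi"
proof (rule equivpI)
  show "reflp cong_2pi"
    by (auto intro!: reflpI exI[of _ 0] simp: cong_2pi_def)
  show "symp cong_2pi"
  proof (rule sympI)
    fix a b assume "cong_2pi a b"
    then obtain k :: int where "b = a + 2 * pi * of_int k" by (auto simp: cong_2pi_def)
    then have "a = b + 2 * pi * of_int (- k)" by simp
    then show "cong_2pi b a" unfolding cong_2pi_def by blast
  qed
  show "transp cong_2pi"
  proof (rule transpI)
    fix a b c assume "cong_2pi a b" "cong_2pi b c"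
    then obtain k l :: int where "b = a + 2 * pi * of_int k" "c = b + 2 * pi * of_int l"
      by (auto simp: cong_2pi_def)
    then have "c = a + 2 * pi * of_int (k + l)" by (simp add: algebra_simps)
    then show "cong_2pi a c" unfolding cong_2pi_def by blast
  qed
qed

quotient_type circle = real / cong_2pi
  morphisms rep_circle proj_circle
  by (rule equivp_cong_2pi)

lemma proj_circle_eq_iff: "proj_circle a = proj_circle b \<longleftrightarrow> cong_2pi a b"
  by (rule circle.abs_eq_iff)

text \<open>Counterclockwise rotation by \<open>a\<close> radians.\<close>

definition rotation :: "real \<Rightarrow> plane \<Rightarrow> plane" where
  "rotation a u = vector [cos a * u $ 1 - sin a * u $ 2, sin a * u $ 1 + cos a * u $ 2]"

definition has_oriented_angle :: "plane \<Rightarrow> plane \<Rightarrow> real \<Rightarrow> bool" where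
  "has_oriented_angle u v a \<longleftrightarrow> v /\<^sub>R norm v = rotation a (u /\<^sub>R norm u)"

definition oriented_angle :: "plane \<Rightarrow> plane \<Rightarrow> circle" where
  "oriented_angle u v = (THE \<theta>. \<exists>a. \<theta> = proj_circle a \<and> has_oriented_angle u v a)"

lemma has_oriented_angle_cong:
  assumes "has_oriented_angle u v a" "cong_2pi a b"
  shows "has_oriented_angle u v b"
proof -
  obtain k :: int where b: "b = a + 2 * pi * of_int k" using assms(2) by (auto simp: cong_2pi_def)
  have "cos b = cos a" "sin b = sin a"
    unfolding b cos_add sin_add by simp_all
  then show ?thesis using assms(1) by (simp add: has_oriented_angle_def rotation_def)
qed

lemma unit_vector_component_squares:
  fixes u :: plane
  assumes "u \<noteq> 0"
  shows "((u /\<^sub>R norm u) $ 1)\<^sup>2 + ((u /\<^sub>R norm u) $ 2)\<^sup>2 = 1"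
proof -
  have "norm (u /\<^sub>R norm u) = 1" using assms by simp
  then show ?thesis by (simp only: norm_vec_def L2_set_def sum_2 real_norm_def power2_abs real_sqrt_eq_1_iff)
qed

lemma has_oriented_angle_ex:
  assumes "u \<noteq> 0" "v \<noteq> 0"
  shows "\<exists>a. has_oriented_angle u v a"
proof -
  define p q where "p = u /\<^sub>R norm u" and "q = v /\<^sub>R norm v"
  have p: "(p $ 1)\<^sup>2 + (p $ 2)\<^sup>2 = 1" and q: "(q $ 1)\<^sup>2 + (q $ 2)\<^sup>2 = 1"
    unfolding p_def q_def using assms by (simp_all only: unit_vector_component_squares not_False_eq_True)
  have "(p$1 * q$1 + p$2 * q$2)\<^sup>2 + (p$1 * q$2 - p$2 * q$1)\<^sup>2
      = ((p $ 1)\<^sup>2 + (p $ 2)\<^sup>2) * ((q $ 1)\<^sup>2 + (q $ 2)\<^sup>2)"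
    by (simp add: power2_eq_square algebra_simps)
  then have "(p$1 * q$1 + p$2 * q$2)\<^sup>2 + (p$1 * q$2 - p$2 * q$1)\<^sup>2 = 1"
    unfolding p q by simp
  then obtain a where a: "p$1 * q$1 + p$2 * q$2 = cos a" "p$1 * q$2 - p$2 * q$1 = sin a"
    using sincos_total_2pi by metis
  have "q $ 1 = ((p $ 1)\<^sup>2 + (p $ 2)\<^sup>2) * q $ 1" "q $ 2 = ((p $ 1)\<^sup>2 + (p $ 2)\<^sup>2) * q $ 2"
    using p by simp_all
  then have "q $ 1 = cos a * p $ 1 - sin a * p $ 2" "q $ 2 = sin a * p $ 1 + cos a * p $ 2"
    unfolding a[symmetric] by (simp_all add: power2_eq_square algebra_simps)
  then have "q = rotation a p"
    by (simp add: rotation_def vec_eq_iff forall_2)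
  then show ?thesis unfolding has_oriented_angle_def p_def q_def by blast
qed

lemma has_oriented_angle_unique:
  assumes "u \<noteq> 0" "has_oriented_angle u v a" "has_oriented_angle u v b"
  shows "cong_2pi a b"
proof -
  define p where "p = u /\<^sub>R norm u"
  have p: "(p $ 1)\<^sup>2 + (p $ 2)\<^sup>2 = 1"
    unfolding p_def using assms(1) by (rule unit_vector_component_squares)
  have "rotation a p = rotation b p"
    using assms(2,3) by (simp add: has_oriented_angle_def p_def)
  then have "cos a * p$1 - sin a * p$2 = cos b * p$1 - sin b * p$2"
            "sin a * p$1 + cos a * p$2 = sin b * p$1 + cos b * p$2"
    by (simp_all add: rotation_def vec_eq_iff forall_2)
  then have e: "(cos a - cos b) * p$1 = (sin a - sin b) * p$2"
               "(sin a - sin b) * p$1 = - (cos a - cos b) * p$2"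
    by (simp_all add: algebra_simps)
  have "(cos a - cos b) * ((p $ 1)\<^sup>2 + (p $ 2)\<^sup>2)
      = (cos a - cos b) * p$1 * p$1 + (cos a - cos b) * p$2 * p$2"
    "(sin a - sin b) * ((p $ 1)\<^sup>2 + (p $ 2)\<^sup>2)
      = (sin a - sin b) * p$1 * p$1 + (sin a - sin b) * p$2 * p$2"
    by (simp_all add: power2_eq_square algebra_simps)
  then have "cos a - cos b = (sin a - sin b) * p$2 * p$1 + (cos a - cos b) * p$2 * p$2"
    "sin a - sin b = - (cos a - cos b) * p$2 * p$1 + (sin a - sin b) * p$2 * p$2"
    unfolding p e by simp_all
  moreover have "(sin a - sin b) * p$2 * p$1 = - (cos a - cos b) * p$2 * p$2"
    using arg_cong[OF e(2), of "\<lambda>r. r * p$2"] by (simp add: mult_ac)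
  moreover have "(cos a - cos b) * p$2 * p$1 = (sin a - sin b) * p$2 * p$2"
    using arg_cong[OF e(1), of "\<lambda>r. r * p$2"] by (simp add: mult_ac)
  ultimately have "sin b = sin a \<and> cos b = cos a" by linarith
  then obtain k :: int where "b = a + 2 * pi * of_int k"
    unfolding sin_cos_eq_iff by blast
  then show ?thesis by (auto simp: cong_2pi_def)
qed

lemma oriented_angle_eq_iff:
  assumes "u \<noteq> 0" "v \<noteq> 0"
  shows "oriented_angle u v = proj_circle a \<longleftrightarrow> has_oriented_angle u v a"
proof -
  obtain b where b: "has_oriented_angle u v b" using has_oriented_angle_ex assms by blast
  have "oriented_angle u v = proj_circle b"
    unfolding oriented_angle_def
  proof (rule the_equality)
    show "\<exists>a. proj_circle b = proj_circle a \<and> has_oriented_angle u v a" using b by blast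
    fix \<theta> assume "\<exists>a. \<theta> = proj_circle a \<and> has_oriented_angle u v a"
    then obtain a where a: "\<theta> = proj_circle a" "has_oriented_angle u v a" by blast
    show "\<theta> = proj_circle b"
      unfolding a(1) proj_circle_eq_iff using assms(1) a(2) b by (rule has_oriented_angle_unique)
  qed
  then have "oriented_angle u v = proj_circle a \<longleftrightarrow> cong_2pi b a"
    by (simp only: proj_circle_eq_iff)
  also have "\<dots> \<longleftrightarrow> has_oriented_angle u v a"
    using has_oriented_angle_unique[OF assms(1) b] has_oriented_angle_cong[OF b] by iprover
  finally show ?thesis .
qed

definition continuous_determination :: "real set \<Rightarrow> (real \<Rightarrow> circle) \<Rightarrow> (real \<Rightarrow> real) \<Rightarrow> bool" where
  "continuous_determination I f \<phi> \<longleftrightarrow> continuous_on I \<phi> \<and> (\<forall>t\<in>I. proj_circle (\<phi> t) = f t)"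

text \<open>The common value of \<open>\<phi> 1 - \<phi> 0\<close> over all continuous determinations \<open>\<phi>\<close>; unspecified if there
  is none.\<close>

definition angle_variation :: "(real \<Rightarrow> circle) \<Rightarrow> real" where
  "angle_variation f = (THE r. \<exists>\<phi>. continuous_determination {0..1} f \<phi> \<and> r = \<phi> 1 - \<phi> 0)"

lemma angle_variation_eq:
  assumes "continuous_determination {0..1} f \<phi>"
  shows "angle_variation f = \<phi> 1 - \<phi> 0"
proof -
  have "\<psi> 1 - \<psi> 0 = \<phi> 1 - \<phi> 0" if \<psi>: "continuous_determination {0..1} f \<psi>" for \<psi>
  proof -
    define d where "d t = (\<psi> t - \<phi> t) / (2 * pi)" for t
    have "continuous_on {0..1} d"
      using assms \<psi> unfolding d_def continuous_determination_def by (auto intro!: continuous_intros)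
    moreover have Z: "d t \<in> \<int>" if "t \<in> {0..1}" for t
    proof -
      have "proj_circle (\<phi> t) = proj_circle (\<psi> t)"
        using assms \<psi> that by (simp only: continuous_determination_def)
      then obtain k :: int where "\<psi> t = \<phi> t + 2 * pi * of_int k"
        unfolding proj_circle_eq_iff cong_2pi_def by blast
      then have "d t = of_int k" by (simp add: d_def)
      then show ?thesis by simp
    qed
    have "\<exists>e>0. \<forall>y. y \<in> {0..1} \<and> d y \<noteq> d x \<longrightarrow> e \<le> norm (d y - d x)"
      if "x \<in> {0..1}" for x
    proof (intro exI[of _ 1] conjI allI impI)
      fix y assume y: "y \<in> {0..1} \<and> d y \<noteq> d x"
      then have "d y - d x \<in> \<int>" using Z that by (intro Ints_diff) simp_all
      then show "1 \<le> norm (d y - d x)" using y by (simp add: Ints_nonzero_abs_ge1)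
    qed simp
    ultimately have "d constant_on {0..1}"
      by (intro continuous_discrete_range_constant) simp_all
    then obtain c where "\<And>t. t \<in> {0..1} \<Longrightarrow> d t = c" unfolding constant_on_def by blast
    from this[of 0] this[of 1] have "d 0 = d 1" by simp
    then show ?thesis by (simp add: d_def)
  qed
  then show ?thesis
    unfolding angle_variation_def using assms by (intro the_equality) blast+
qed

subsection \<open>Torsion and linking number at time 1\<close>

definition Torsion1 :: "(real \<Rightarrow> plane \<Rightarrow> plane) \<Rightarrow> plane \<Rightarrow> plane \<Rightarrow> real" where
  "Torsion1 F z \<xi> =
     angle_variation (\<lambda>t. oriented_angle (vector [1, 0]) (frechet_derivative (F t) (at z) \<xi>))"

definition Linking1 :: "(real \<Rightarrow> plane \<Rightarrow> plane) \<Rightarrow> plane \<Rightarrow> plane \<Rightarrow> real" where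
  "Linking1 F x y = angle_variation (\<lambda>t. oriented_angle (vector [1, 0]) (F t y - F t x))"

end

theory Submission
  imports Defs "HOL-Complex_Analysis.Riemann_Mapping"
begin

text \<open>
  Write \<open>g\<^sub>t(s) = F\<^sub>t(x + s(y - x))\<close>. The directions of the chords from \<open>g\<^sub>t(s)\<close> to \<open>g\<^sub>t(r)\<close>, \<open>s \<le> r\<close>, extended
  by the tangent direction for \<open>s = r\<close>, depend continuously on \<open>(t, s, r)\<close> in a convex set, hence have a
  continuous determination \<open>A(t, s, r)\<close>, and \<open>A(0, s, r)\<close> is constant. It remains to show for the arc
  \<open>g = g\<^sub>1\<close> with chord angle \<open>a(s, r) = A(1, s, r)\<close> that \<open>a(s, s) = a(0, 1)\<close> for some \<open>s\<close>.

  Among all chords with angle \<open>a(0, 1)\<close> take a shortest one; if it is not degenerate, we may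
  assume that it goes from \<open>g(0) = 0\<close> to \<open>g(1) = 1\<close> and that \<open>a(0, 1) = 0\<close>. If \<open>a(s, s)\<close> never vanishes,
  then \<open>a(s, 1) - a(0, s)\<close> changes sign between \<open>s = 0\<close> and \<open>s = 1\<close>, and at a zero the arc crosses the
  open chord. By minimality, at every crossing \<open>g(q)\<close> both \<open>a(0, q)\<close> and \<open>a(q, 1)\<close> are non-zero multiples
  of \<open>2\<pi>\<close>; by continuity the crossings do not accumulate at the end points.
  Let \<open>g(q)\<close> and \<open>g(q')\<close> be the crossings nearest to \<open>0\<close> and to \<open>1\<close>. The loop \<open>X\<close> made of \<open>g\<close> on \<open>[0, q]\<close>
  and a piece of the chord is a Jordan curve which winds around \<open>1\<close>, and the loop \<open>Y\<close> made of \<open>g\<close> on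
  \<open>[q', 1]\<close> and a piece of the chord winds around \<open>0\<close>. Then \<open>Y\<close> does not meet the outside of \<open>X\<close>,
  although \<open>0\<close> lies both on \<open>X\<close> and inside \<open>Y\<close>, a contradiction.
\<close>

subsection \<open>Chord angles of plane arcs\<close>

lemma cis_eq_cis_iff: "cis a = cis b \<longleftrightarrow> (\<exists>k::int. a = b + 2 * pi * of_int k)"
  by (metis cis.sel complex_eq_iff sin_cos_eq_iff)

lemma cis_lifts_differ_by_constant:
  fixes f g :: "'a::topological_space \<Rightarrow> real"
  assumes "connected S" "continuous_on S f" "continuous_on S g"
    and eq: "\<And>x. x \<in> S \<Longrightarrow> cis (f x) = cis (g x)"
  obtains c where "\<And>x. x \<in> S \<Longrightarrow> f x = g x + c"
proof -
  define d where "d x = (f x - g x) / (2 * pi)" for x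
  have cont: "continuous_on S d"
    using assms(2,3) unfolding d_def by (auto intro!: continuous_intros)
  have Z: "d x \<in> \<int>" if x: "x \<in> S" for x
  proof -
    obtain k :: int where "f x = g x + 2 * pi * of_int k"
      using eq[OF x] cis_eq_cis_iff by blast
    then show ?thesis by (simp add: d_def)
  qed
  have "\<exists>e>0. \<forall>y. y \<in> S \<and> d y \<noteq> d x \<longrightarrow> e \<le> norm (d y - d x)" if "x \<in> S" for x
    using Z that by (intro exI[of _ 1]) (auto intro!: Ints_nonzero_abs_ge1)
  then have "d constant_on S"
    using assms(1) cont by (intro continuous_discrete_range_constant)
  then obtain c where "\<And>x. x \<in> S \<Longrightarrow> d x = c" unfolding constant_on_def by blast
  then have "f x = g x + 2 * pi * c" if "x \<in> S" for x
    using that by (force simp: d_def field_simps)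
  then show ?thesis using that by blast
qed

lemma sgn_exp_complex: "sgn (exp z) = cis (Im z)"
  by (simp add: sgn_eq exp_eq_polar norm_mult)

text \<open>The imaginary part of a continuous logarithm of \<open>p t - \<zeta>\<close> lifts the
  same directions as \<open>\<phi>\<close>, so the two differ by a constant. Open paths are allowed,
  so that the loops below can be treated piece by piece.\<close>

lemma Re_winding_number_eq_angle_change:
  assumes p: "path p" "\<zeta> \<notin> path_image p" and \<phi>: "continuous_on {0..1} \<phi>"
    and sgn: "\<And>t. t \<in> {0..1} \<Longrightarrow> sgn (p t - \<zeta>) = cis (\<phi> t)"
  shows "Re (winding_number p \<zeta>) = (\<phi> 1 - \<phi> 0) / (2 * pi)"
proof -
  obtain q where q: "path q" "pathfinish q - pathstart q = 2 * of_real pi * \<i> * winding_number p \<zeta>"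
    "\<And>t. t \<in> {0..1} \<Longrightarrow> p t = \<zeta> + exp (q t)"
    using winding_number_as_continuous_log[OF p] by blast
  have "continuous_on {0..1} (\<lambda>t. Im (q t))"
    using q(1) by (auto simp: path_def intro!: continuous_intros)
  moreover have "cis (Im (q t)) = cis (\<phi> t)" if "t \<in> {0..1}" for t
    using sgn[OF that] q(3)[OF that] by (simp add: sgn_exp_complex)
  ultimately obtain c where c: "\<And>t. t \<in> {0..1} \<Longrightarrow> Im (q t) = \<phi> t + c"
    using \<phi> cis_lifts_differ_by_constant[of "{0..1}" "\<lambda>t. Im (q t)" \<phi>] by auto
  have "\<phi> 1 - \<phi> 0 = Im (pathfinish q - pathstart q)"
    using c[of 0] c[of 1] by (simp add: pathfinish_def pathstart_def)
  also have "\<dots> = 2 * pi * Re (winding_number p \<zeta>)"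
    unfolding q(2) by simp
  finally show ?thesis by simp
qed

text \<open>For a \<open>C\<^sup>1\<close> regular arc, continuity forces \<open>a (s, s)\<close> to be an angle of the tangent.\<close>

definition chord_angle :: "(real \<Rightarrow> complex) \<Rightarrow> (real \<times> real \<Rightarrow> real) \<Rightarrow> bool" where
  "chord_angle g a \<longleftrightarrow> continuous_on {(s, r). 0 \<le> s \<and> s \<le> r \<and> r \<le> 1} a \<and>
     (\<forall>s r. 0 \<le> s \<and> s < r \<and> r \<le> 1 \<longrightarrow> cis (a (s, r)) = sgn (g r - g s))"

lemma chord_angleD:
  "chord_angle g a \<Longrightarrow> 0 \<le> s \<Longrightarrow> s < r \<Longrightarrow> r \<le> 1 \<Longrightarrow> cis (a (s, r)) = sgn (g r - g s)"
  by (simp add: chord_angle_def)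

text \<open>A vanishing chord would have \<open>sgn\<close> equal to 0, which is not a value of
  \<open>cis\<close>.\<close>

lemma chord_angle_inj_on:
  assumes "chord_angle g a"
  shows "inj_on g {0..1}"
proof (rule linorder_inj_onI')
  fix s r :: real assume "s \<in> {0..1}" "r \<in> {0..1}" "s < r"
  then have "cis (a (s, r)) = sgn (g r - g s)"
    using assms by (intro chord_angleD) auto
  then show "g s \<noteq> g r"
    by (metis cis_neq_zero right_minus_eq sgn_0)
qed

lemma chord_angle_continuous_on:
  assumes "chord_angle g a" "continuous_on S u" "continuous_on S v"
    and "\<And>x. x \<in> S \<Longrightarrow> 0 \<le> u x \<and> u x \<le> v x \<and> v x \<le> 1"
  shows "continuous_on S (\<lambda>x. a (u x, v x))"
  using assms(1)[unfolded chord_angle_def, THEN conjunct1]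
  by (rule continuous_on_compose2) (use assms in \<open>auto intro!: continuous_intros\<close>)

section \<open>Jordan curves built from the extreme crossings\<close>

text \<open>By \<open>free\<close> and \<open>free'\<close> the crossings at \<open>c\<close> and
  \<open>c'\<close> are those nearest to 0 and to 1, while \<open>q\<close> and \<open>q'\<close>
  may come in either order along the arc. The angles in \<open>turn\<close> become winding numbers
  of two loops that cannot coexist.\<close>

lemma extreme_chord_crossings_absurd:
  assumes g: "path g" and a: "chord_angle g a" and g01: "g 0 = 0" "g 1 = 1" and a01: "a (0, 1) = 0"
    and q: "0 < q" "q < 1" "0 < q'" "q' < 1"
    and gq: "g q = of_real c" "g q' = of_real c'" and c: "0 < c" "c < 1" "0 < c'" "c' < 1"
    and free: "\<And>t x. t \<in> {0..1} \<Longrightarrow> g t = of_real x \<Longrightarrow> 0 < x \<Longrightarrow> c \<le> x"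
    and free': "\<And>t x. t \<in> {0..1} \<Longrightarrow> g t = of_real x \<Longrightarrow> x < 1 \<Longrightarrow> x \<le> c'"
    and turn: "a (q, 1) \<noteq> 0" "a (0, q') \<noteq> 0"
  shows False
proof -
  note inj = chord_angle_inj_on[OF a]
  have arc: "arc g" using g inj by (simp add: arc_def)
  have cc': "c \<le> c'" using free[of q' c'] q c gq by auto
  define X where "X = subpath 0 q g +++ linepath (of_real c) 0"
  define Y where "Y = subpath q' 1 g +++ linepath 1 (of_real c')"
  have seg: "closed_segment (of_real x) (of_real y) = complex_of_real ` closed_segment x y" for x y
    by (rule closed_segment_of_real)
  have imX: "path_image X = g ` {0..q} \<union> of_real ` {0..c}"
    using seg[of c 0] q c unfolding X_def
    by (subst path_image_join) (simp_all add: path_image_subpath gq closed_segment_eq_real_ivl)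
  have imY: "path_image Y = g ` {q'..1} \<union> of_real ` {c'..1}"
    using seg[of 1 c'] q c unfolding Y_def
    by (subst path_image_join) (simp_all add: path_image_subpath g01 closed_segment_eq_real_ivl)
  have pX: "path X" and loopX: "pathfinish X = pathstart X"
    using g q by (auto simp: X_def gq g01)
  have pY: "path Y" and loopY: "pathfinish Y = pathstart Y"
    using g q by (auto simp: Y_def gq g01)
  have g1: "1 \<notin> g ` {0..q}"
  proof
    assume "1 \<in> g ` {0..q}"
    then obtain t where "t \<in> {0..q}" "g t = g 1" using g01 by auto
    then show False using inj_onD[OF inj, of t 1] q by auto
  qed
  have g0: "0 \<notin> g ` {q'..1}"
  proof
    assume "0 \<in> g ` {q'..1}"
    then obtain t where "t \<in> {q'..1}" "g t = g 0" using g01 by auto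
    then show False using inj_onD[OF inj, of t 0] q by auto
  qed
  have 1: "1 \<notin> path_image X"
    unfolding imX using g1 c by auto
  have 0: "0 \<notin> path_image Y"
    unfolding imY using g0 c by auto

  \<comment> \<open>Seen from 1, the point \<open>g t\<close> lies in the direction of a reversed
    chord, with angle \<open>a (t, 1) + pi\<close>. This changes by
    \<open>a (q, 1) - a (0, 1)\<close>, which is non-zero by \<open>turn\<close>.\<close>
  have "Re (winding_number (subpath 0 q g) 1) = ((a (q * 1, 1) + pi) - (a (q * 0, 1) + pi)) / (2 * pi)"
  proof (rule Re_winding_number_eq_angle_change)
    show "continuous_on {0..1} (\<lambda>t. a (q * t, 1) + pi)"
      using q by (intro continuous_intros chord_angle_continuous_on[OF a])
        (auto intro!: mult_le_one)
    show "sgn (subpath 0 q g t - 1) = cis (a (q * t, 1) + pi)" if "t \<in> {0..1}" for t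
    proof -
      have "q * t \<le> q" using that q by (simp add: mult_left_le)
      then have "q * t < 1" using q by linarith
      then have "cis (a (q * t, 1)) = sgn (1 - g (q * t))"
        using chord_angleD[OF a, of "q * t" 1] that q g01 by simp
      moreover have "sgn (g (q * t) - 1) = - sgn (1 - g (q * t))"
        by (simp flip: sgn_minus)
      ultimately show ?thesis
        by (simp add: subpath_def cis_mult[symmetric])
    qed
  qed (use g q g1 in \<open>auto simp: path_image_subpath\<close>)
  \<comment> \<open>The straight piece lies to the left of 1 and is seen from there in the constant
    direction -1.\<close>
  moreover have "Re (winding_number (linepath (of_real c) 0) 1) = (pi - pi) / (2 * pi)"
  proof (rule Re_winding_number_eq_angle_change)
    show "sgn (linepath (complex_of_real c) 0 t - 1) = cis pi" if "t \<in> {0..1}" for t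
    proof -
      have "(1 - t) * c < 1" using that c by (smt (verit) atLeastAtMost_iff mult_left_le_one_le)
      then have "sgn ((1 - t) * c - 1) = - 1" by simp
      then have "sgn (complex_of_real ((1 - t) * c - 1)) = of_real (- 1)"
        by (simp only: sgn_of_real)
      then show ?thesis by (simp add: linepath_def scaleR_conv_of_real)
    qed
  qed (use 1 in \<open>auto simp: X_def path_image_join gq\<close>)
  ultimately have "Re (winding_number X 1) \<noteq> 0"
    unfolding X_def using g q 1 turn a01
    by (subst winding_number_join) (auto simp: X_def gq path_image_join)
  then have in1: "1 \<in> inside (path_image X)"
    using winding_number_zero_in_outside[OF pX loopX, of 1] 1 by (auto simp: inside_outside)

  \<comment> \<open>Dually, \<open>a (0, t)\<close> is the angle of \<open>g t\<close> as seen from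
    0, and the straight piece of \<open>Y\<close> adds nothing.\<close>
  have "Re (winding_number (subpath q' 1 g) 0) = (a (0, q' + (1 - q') * 1) - a (0, q' + (1 - q') * 0)) / (2 * pi)"
  proof (rule Re_winding_number_eq_angle_change)
    have *: "0 < q' + (1 - q') * t \<and> q' + (1 - q') * t \<le> 1" if "t \<in> {0..1}" for t
    proof -
      have "(1 - q') * t \<le> 1 - q'" "0 \<le> (1 - q') * t"
        using that q by (simp_all add: mult_left_le)
      then show ?thesis using q by linarith
    qed
    show "continuous_on {0..1} (\<lambda>t. a (0, q' + (1 - q') * t))"
      using * by (intro continuous_intros chord_angle_continuous_on[OF a]) force
    show "sgn (subpath q' 1 g t - 0) = cis (a (0, q' + (1 - q') * t))" if "t \<in> {0..1}" for t
      using chord_angleD[OF a, of 0 "q' + (1 - q') * t"] *[OF that] g01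
      by (simp add: subpath_def algebra_simps)
  qed (use g q g0 in \<open>auto simp: path_image_subpath\<close>)
  moreover have "Re (winding_number (linepath 1 (of_real c')) 0) = (0 - 0) / (2 * pi)"
  proof (rule Re_winding_number_eq_angle_change)
    show "sgn (linepath 1 (complex_of_real c') t - 0) = cis 0" if "t \<in> {0..1}" for t
    proof -
      have "(1 - t) + t * c' > 0"
        using that c by (cases "t = 0") (auto intro!: add_nonneg_pos)
      then have "sgn ((1 - t) + t * c') = 1" by simp
      then have "sgn (complex_of_real ((1 - t) + t * c')) = of_real 1"
        by (simp only: sgn_of_real)
      then show ?thesis by (simp add: linepath_def scaleR_conv_of_real)
    qed
  qed (use 0 in \<open>auto simp: Y_def path_image_join g01\<close>)
  ultimately have "Re (winding_number Y 0) \<noteq> 0"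
    unfolding Y_def using g q 0 turn a01
    by (subst winding_number_join) (auto simp: Y_def g01 path_image_join)
  then have in0: "0 \<in> inside (path_image Y)"
    using winding_number_zero_in_outside[OF pY loopY, of 0] 0 by (auto simp: inside_outside)

  \<comment> \<open>By \<open>free\<close> the arc meets the chord piece [0, c] only in 0 and c.
    Jordan's theorem then makes every point of \<open>X\<close> a limit of points outside
    \<open>X\<close>.\<close>
  have "simple_path X"
    unfolding X_def
  proof (rule simple_path_join_loop)
    show "arc (subpath 0 q g)" using arc q by (intro arc_subpath_arc) auto
    show "path_image (subpath 0 q g) \<inter> path_image (linepath (of_real c) 0)
        \<subseteq> {pathstart (subpath 0 q g), pathstart (linepath (of_real c) 0)}"
    proof -
      have "z = 0 \<or> z = of_real c" if "z \<in> g ` {0..q}" "z \<in> of_real ` {0..c}" for z :: complex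
        using that free q by (force simp: image_iff)
      then show ?thesis
        using q c seg[of c 0] by (auto simp: path_image_subpath g01 gq closed_segment_eq_real_ivl)
    qed
  qed (use c q gq g01 in auto)
  from Jordan_inside_outside[OF this loopX]
  have J: "path_image X = frontier (outside (path_image X))" by auto

  \<comment> \<open>\<open>Y0\<close> is the part of \<open>Y\<close> off \<open>X\<close>, up to limit points.\<close>
  define m where "m = max q q'"
  have m: "0 < m" "m < 1"
    using q by (auto simp: m_def)
  define Y0 where "Y0 = g ` {m<..1} \<union> complex_of_real ` {c'<..1}"
  have "connected Y0"
    unfolding Y0_def
  proof (rule connected_Un)
    show "connected (g ` {m<..1})"
      using g q by (intro connected_continuous_image) (auto simp: path_def m_def intro: continuous_on_subset)
    show "connected (complex_of_real ` {c'<..1})"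
      by (intro connected_continuous_image continuous_intros) auto
    show "g ` {m<..1} \<inter> complex_of_real ` {c'<..1} \<noteq> {}"
      using g01 m c by (metis IntI emptyE greaterThanAtMost_iff imageI order_refl of_real_1)
  qed
  \<comment> \<open>Arc and arc are disjoint by injectivity, arc and chord by \<open>free\<close> or
    \<open>free'\<close> together with injectivity, chord and chord by
    \<open>c \<le> c'\<close>.\<close>
  moreover have "Y0 \<inter> path_image X = {}"
  proof -
    have "g ` {m<..1} \<inter> g ` {0..q} = g ` ({m<..1} \<inter> {0..q})"
      using q by (intro inj_on_image_Int[OF inj, symmetric]) (auto simp: m_def)
    then have "g ` {m<..1} \<inter> g ` {0..q} = {}"
      by (auto simp: m_def)
    moreover have "g ` {m<..1} \<inter> of_real ` {0..c} = {}"
    proof -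
      have False if t: "m < t" "t \<le> 1" and x: "0 \<le> x" "x \<le> c" "g t = of_real x" for t x
      proof -
        have "x = 0 \<or> x = c" using free[of t x] t x m by force
        then have "g t = g 0 \<or> g t = g q" using x gq g01 by auto
        then show False using inj_onD[OF inj, of t 0] inj_onD[OF inj, of t q] t q by (auto simp: m_def)
      qed
      then show ?thesis by force
    qed
    moreover have "of_real ` {c'<..1} \<inter> g ` {0..q} = {}"
    proof -
      have False if t: "0 \<le> t" "t \<le> q" and x: "c' < x" "x \<le> 1" "g t = of_real x" for t x
      proof -
        have "x = 1" using free'[of t x] t x q by force
        then have "g t = g 1" using x g01 by auto
        then show False using inj_onD[OF inj, of t 1] t q by auto
      qed
      then show ?thesis by force
    qed
    moreover have "complex_of_real ` {c'<..1} \<inter> of_real ` {0..c} = {}"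
      using cc' by auto
    ultimately show ?thesis unfolding Y0_def imX by blast
  qed
  moreover have "1 \<in> Y0" using c by (force simp: Y0_def)
  \<comment> \<open>A connected set that misses \<open>X\<close> and contains the point 1 inside
    \<open>X\<close> cannot reach the outside of \<open>X\<close>.\<close>
  ultimately have Y0: "Y0 \<inter> outside (path_image X) = {}"
    using inside_outside_intersect_connected[of Y0 "path_image X"] in1 by blast
  have "path_image Y \<subseteq> closure Y0 \<union> path_image X"
  proof -
    have A: "of_real ` {c'..1} \<subseteq> closure (complex_of_real ` {c'<..1})"
      using c image_closure_subset[of "{c'<..1}" complex_of_real "closure (of_real ` {c'<..1})"]
      by (auto intro!: continuous_intros simp: closure_subset)
    have "continuous_on {m..1} g"
      using g m by (auto simp: path_def intro: continuous_on_subset)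
    then have B: "g ` {m..1} \<subseteq> closure (g ` {m<..1})"
      using m image_closure_subset[of "{m<..1}" g "closure (g ` {m<..1})"]
      by (simp add: closure_subset)
    \<comment> \<open>If \<open>q' < q\<close>, the part of the arc over [q', q] already lies on
      \<open>X\<close>; this is why \<open>Y0\<close> starts after \<open>m\<close>.\<close>
    have "{q'..1} \<subseteq> {m..1} \<union> {0..q}"
      using q by (auto simp: m_def)
    then have "g ` {q'..1} \<subseteq> g ` {m..1} \<union> g ` {0..q}"
      by (metis image_Un image_mono)
    then have C: "g ` {q'..1} \<subseteq> closure (g ` {m<..1}) \<union> g ` {0..q}"
      by (rule order_trans[OF _ Un_mono[OF B order_refl]])
    show ?thesis
      unfolding imX imY Y0_def closure_Un
      by (intro Un_least order_trans[OF A] order_trans[OF C]) auto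
  qed
  moreover have "open (outside (path_image X))"
    using pX by (intro open_outside closed_path_image)
  then have "outside (path_image X) \<inter> closure Y0 = {}"
    by (subst open_Int_closure_eq_empty) (use Y0 in auto)
  ultimately have YX: "path_image Y \<inter> outside (path_image X) = {}"
    using outside_no_overlap[of "path_image X"] by blast

  \<comment> \<open>Points outside \<open>X\<close> accumulate at 0, which has a neighbourhood
    inside \<open>Y\<close>; so some \<open>z\<close> is both inside \<open>Y\<close> and outside
    \<open>X\<close>.\<close>
  have "0 \<in> path_image X" using c by (force simp: imX)
  then have "0 \<in> closure (outside (path_image X))"
    using J unfolding frontier_def by blast
  moreover have "open (inside (path_image Y))"
    using pY by (intro open_inside closed_path_image)
  ultimately obtain z where z: "z \<in> inside (path_image Y)" "z \<in> outside (path_image X)"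
    using in0 by (meson closure_iff_nhds_not_empty disjoint_iff order_refl)
  \<comment> \<open>The outside of \<open>X\<close> is connected and misses \<open>Y\<close>, so it
    stays in the bounded component of \<open>z\<close>; but it is unbounded.\<close>
  have "connected (outside (path_image X))"
    using pX by (intro connected_outside bounded_path_image) auto
  then have "outside (path_image X) \<subseteq> connected_component_set (- path_image Y) z"
    using z YX by (intro connected_component_maximal) auto
  moreover have "bounded (connected_component_set (- path_image Y) z)"
    using z by (simp add: inside_def)
  ultimately show False
    using unbounded_outside[OF bounded_path_image[OF pX]] bounded_subset by blast
qed

section \<open>Reduction to a shortest chord, normalised to [0, 1]\<close>

lemma affine_in_unit_interval:
  fixes u v t :: real
  assumes "0 \<le> u" "u \<le> v" "v \<le> 1" "0 \<le> t" "t \<le> 1"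
  shows "0 \<le> u + t * (v - u) \<and> u + t * (v - u) \<le> 1"
proof -
  have "0 \<le> t * (v - u)" "t * (v - u) \<le> v - u"
    using assms by (simp_all add: mult_left_le_one_le)
  then show ?thesis using assms by linarith
qed

text \<open>Dividing by \<open>g v - g u\<close> turns every direction by
  \<open>- a (u, v)\<close>.\<close>

lemma chord_angle_subarc:
  assumes a: "chord_angle g a" and u: "0 \<le> u" "u < v" "v \<le> 1"
  shows "chord_angle (\<lambda>t. (g (u + t * (v - u)) - g u) / (g v - g u))
    (\<lambda>(s, r). a (u + s * (v - u), u + r * (v - u)) - a (u, v))"
  unfolding chord_angle_def
proof (intro conjI allI impI)
  have *: "0 \<le> u + t * (v - u) \<and> u + t * (v - u) \<le> 1" if "0 \<le> t" "t \<le> 1" for t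
    using affine_in_unit_interval[of u v t] that u by simp
  show "continuous_on {(s, r). 0 \<le> s \<and> s \<le> r \<and> r \<le> 1}
      (\<lambda>(s, r). a (u + s * (v - u), u + r * (v - u)) - a (u, v))"
    unfolding case_prod_unfold
    using * u by (intro chord_angle_continuous_on[OF a] continuous_intros)
      (auto intro: mult_right_mono)
  fix s r :: real assume sr: "0 \<le> s \<and> s < r \<and> r \<le> 1"
  then have less: "u + s * (v - u) < u + r * (v - u)"
    using u by simp
  have "cis (a (u + s * (v - u), u + r * (v - u)) - a (u, v))
      = sgn (g (u + r * (v - u)) - g (u + s * (v - u))) / sgn (g v - g u)"
    using chord_angleD[OF a _ less] chord_angleD[OF a u] *[of s] *[of r] sr
    by (simp flip: cis_divide)
  also have "\<dots> = sgn ((g (u + r * (v - u)) - g u) / (g v - g u)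
      - (g (u + s * (v - u)) - g u) / (g v - g u))"
    by (simp add: sgn_eq norm_divide flip: diff_divide_distrib)
  finally show "cis (case (s, r) of (s, r) \<Rightarrow> a (u + s * (v - u), u + r * (v - u)) - a (u, v))
      = sgn ((g (u + r * (v - u)) - g u) / (g v - g u) - (g (u + s * (v - u)) - g u) / (g v - g u))"
    by simp
qed

text \<open>Minimality provides what \<open>extreme_chord_crossings_absurd\<close> requires: it
  yields \<open>turn\<close>, and it keeps the crossings away from the end points, so that extreme
  ones exist.\<close>

lemma chord_crossing_absurd:
  assumes g: "path g" and a: "chord_angle g a" and g01: "g 0 = 0" "g 1 = 1" and a01: "a (0, 1) = 0"
    and shortest: "\<And>s r. 0 \<le> s \<Longrightarrow> s \<le> r \<Longrightarrow> r \<le> 1 \<Longrightarrow> a (s, r) = 0 \<Longrightarrow> 1 \<le> cmod (g r - g s)"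
    and cross: "0 \<le> t" "t \<le> 1" "g t = of_real x" "0 < x" "x < 1"
  shows False
proof -
  define K where "K = {t \<in> {0..1}. \<exists>x. 0 < x \<and> x < 1 \<and> g t = of_real x}"
  have K0: "2 * pi \<le> \<bar>a (0, t)\<bar>" and K1: "2 * pi \<le> \<bar>a (t, 1)\<bar>" and K01: "0 < t" "t < 1"
    if tK: "t \<in> K" for t
  proof -
    obtain x where x: "0 < x" "x < 1" "g t = of_real x" and t: "0 \<le> t" "t \<le> 1"
      using tK by (auto simp: K_def)
    show t01: "0 < t" "t < 1"
      using x t g01 by (force simp: less_le)+
    have big: "2 * pi \<le> \<bar>b\<bar>" if "cis b = 1" "b \<noteq> 0" for b
    proof -
      obtain k :: int where k: "b = 2 * pi * of_int k"
        using cis_eq_cis_iff[of b 0] \<open>cis b = 1\<close> by auto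
      then have "1 \<le> \<bar>real_of_int k\<bar>"
        using \<open>b \<noteq> 0\<close> by (cases "k = 0") auto
      then show ?thesis
        using k by (simp add: abs_mult)
    qed
    \<comment> \<open>The chords joining a crossing to the end points have direction 1, so their
      angles are multiples of 2 pi; being shorter than 1, they cannot have angle 0.\<close>
    have "cis (a (0, t)) = 1" "cis (a (t, 1)) = 1"
      using chord_angleD[OF a, of 0 t] chord_angleD[OF a, of t 1] t01 x g01 sgn_of_real[of "1 - x", where 'a = complex]
      by (simp_all add: sgn_of_real)
    moreover have "cmod (g t - g 0) < 1" "cmod (g 1 - g t) < 1"
      using x g01 norm_of_real[of "1 - x", where 'a = complex] by simp_all
    then have "a (0, t) \<noteq> 0" "a (t, 1) \<noteq> 0"
      using shortest[of 0 t] shortest[of t 1] t by force+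
    ultimately show "2 * pi \<le> \<bar>a (0, t)\<bar>" "2 * pi \<le> \<bar>a (t, 1)\<bar>"
      using big by blast+
  qed
  have cont: "continuous_on {0..1} (\<lambda>t. a (t, 1))" "continuous_on {0..1} (\<lambda>t. a (0, t))"
    by (intro chord_angle_continuous_on[OF a] continuous_intros; simp)+
  \<comment> \<open>As \<open>a (t, 1)\<close> is small for t near 0 and \<open>a (0, t)\<close> for
    t near 1, no crossing parameter is within \<open>d\<close> of 0 or within \<open>d'\<close> of
    1.\<close>
  obtain d where d: "0 < d" "\<And>t. t \<in> {0..1} \<Longrightarrow> \<bar>t\<bar> < d \<Longrightarrow> \<bar>a (t, 1)\<bar> < 2 * pi"
    using cont(1)[unfolded continuous_on_iff, rule_format, of 0 "2 * pi"] a01 pi_gt_zero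
    by (auto simp: dist_real_def)
  obtain d' where d': "0 < d'" "\<And>t. t \<in> {0..1} \<Longrightarrow> \<bar>t - 1\<bar> < d' \<Longrightarrow> \<bar>a (0, t)\<bar> < 2 * pi"
    using cont(2)[unfolded continuous_on_iff, rule_format, of 1 "2 * pi"] a01 pi_gt_zero
    by (auto simp: dist_real_def)
  \<comment> \<open>Away from the end parameters the open chord can be replaced by the closed one,
    which makes \<open>K\<close> compact.\<close>
  have K_eq: "K = {max 0 d..min 1 (1 - d')} \<inter> g -` of_real ` {0..1}" (is "_ = ?R")
  proof (intro equalityI subsetI)
    fix t assume t: "t \<in> K"
    then have "d \<le> \<bar>t\<bar>" "d' \<le> \<bar>t - 1\<bar>"
      using d(2)[of t] d'(2)[of t] K0[of t] K1[of t] by (force simp: K_def not_less[symmetric])+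
    moreover have "g t \<in> of_real ` {0..1}"
      using t by (force simp: K_def)
    ultimately show "t \<in> ?R"
      using K01[OF t] by auto
  next
    fix t assume t: "t \<in> ?R"
    then obtain x where x: "0 \<le> x" "x \<le> 1" "g t = of_real x" by auto
    have "0 < t" "t < 1" using t d d' by auto
    then have "x \<noteq> 0" "x \<noteq> 1"
      using x(3) g01 inj_onD[OF chord_angle_inj_on[OF a], of t 0]
        inj_onD[OF chord_angle_inj_on[OF a], of t 1] by auto
    then show "t \<in> K"
      using x \<open>0 < t\<close> \<open>t < 1\<close> by (auto simp: K_def)
  qed
  have "closed (complex_of_real ` {0..1})"
    by (intro compact_imp_closed compact_continuous_image continuous_intros) auto
  moreover have sub: "{max 0 d..min 1 (1 - d')} \<subseteq> {0..1}" by auto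
  ultimately have "compact K"
    unfolding K_eq compact_eq_bounded_closed using g
    by (intro conjI bounded_Int continuous_closed_preimage disjI1)
      (auto simp: path_def intro: continuous_on_subset)
  moreover have "t \<in> K" using cross by (auto simp: K_def)
  moreover have "continuous_on K (\<lambda>t. Re (g t))"
    using g sub by (intro continuous_intros) (auto simp: path_def K_def intro: continuous_on_subset)
  \<comment> \<open>Extremes are taken in the position along the chord, not in the
    parameter.\<close>
  ultimately obtain q q' where q: "q \<in> K" "\<And>t. t \<in> K \<Longrightarrow> Re (g q) \<le> Re (g t)"
    and q': "q' \<in> K" "\<And>t. t \<in> K \<Longrightarrow> Re (g t) \<le> Re (g q')"
    by (metis continuous_attains_inf continuous_attains_sup empty_iff)
  define c c' where "c = Re (g q)" and "c' = Re (g q')"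
  have gq: "g q = of_real c" "g q' = of_real c'" and c: "0 < c" "c < 1" "0 < c'" "c' < 1"
    using q(1) q'(1) by (auto simp: c_def c'_def K_def)
  have free: "c \<le> x" if "t \<in> {0..1}" "g t = of_real x" "0 < x" for t x
  proof (cases "x < 1")
    case True
    then have "t \<in> K" using that by (auto simp: K_def)
    then show ?thesis using q(2)[of t] that by (simp add: c_def)
  qed (use c in simp)
  have free': "x \<le> c'" if "t \<in> {0..1}" "g t = of_real x" "x < 1" for t x
  proof (cases "0 < x")
    case True
    then have "t \<in> K" using that by (auto simp: K_def)
    then show ?thesis using q'(2)[of t] that by (simp add: c'_def)
  qed (use c in simp)
  have turn: "a (q, 1) \<noteq> 0" "a (0, q') \<noteq> 0"
    using K0[OF q'(1)] K1[OF q(1)] pi_gt_zero by (metis abs_zero not_le mult_pos_pos zero_less_numeral)+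
  note K01' = K01[OF q(1)] K01[OF q'(1)]
  show False
    by (rule extreme_chord_crossings_absurd[OF g a g01 a01 K01' gq c]) (fact free free' turn)+
qed

lemma continuous_on_zero_exists:
  fixes f :: "real \<Rightarrow> real"
  assumes "continuous_on {0..1} f" "f 0 * f 1 \<le> 0"
  obtains t where "t \<in> {0..1}" "f t = 0"
  using assms IVT'[of f 0 0 1] IVT2'[of f 1 0 0] by (force simp: mult_le_0_iff)

lemma shortest_chord_angle_attained:
  assumes g: "path g" and a: "chord_angle g a" and g01: "g 0 = 0" "g 1 = 1" and a01: "a (0, 1) = 0"
    and shortest: "\<And>s r. 0 \<le> s \<Longrightarrow> s \<le> r \<Longrightarrow> r \<le> 1 \<Longrightarrow> a (s, r) = 0 \<Longrightarrow> 1 \<le> cmod (g r - g s)"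
  obtains s where "s \<in> {0..1}" "a (s, s) = 0"
proof (rule ccontr)
  assume no: "\<not> thesis"
  have "continuous_on {0..1} (\<lambda>s. a (s, s))"
    by (intro chord_angle_continuous_on[OF a] continuous_intros) auto
  then have pos: "0 < a (0, 0) * a (1, 1)"
    using no that continuous_on_zero_exists[of "\<lambda>s. a (s, s)"] by (metis not_le)
  \<comment> \<open>Since \<open>a (0, 1) = 0\<close>, the end values are \<open>- a (0, 0)\<close>
    and \<open>a (1, 1)\<close>, of opposite signs by \<open>pos\<close>.\<close>
  have "continuous_on {0..1} (\<lambda>s. a (s, 1) - a (0, s))"
    by (intro chord_angle_continuous_on[OF a] continuous_intros) auto
  then obtain q where q: "q \<in> {0..1}" "a (q, 1) = a (0, q)"
    using pos a01 continuous_on_zero_exists[of "\<lambda>s. a (s, 1) - a (0, s)"] by (auto simp: algebra_simps)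
  have "0 < q" "q < 1"
    using pos q a01 by (auto simp: less_le)
  \<comment> \<open>\<open>g q\<close> and \<open>1 - g q\<close> are positive multiples of the same
    unit vector \<open>u\<close>. Their sum is 1, which forces \<open>u = 1\<close> and puts
    \<open>g q\<close> on the open chord.\<close>
  define u where "u = sgn (g q)"
  have u: "sgn (1 - g q) = u" "cmod u = 1"
  proof -
    have "cis (a (0, q)) = u" "cis (a (q, 1)) = sgn (1 - g q)"
      using chord_angleD[OF a, of 0 q] chord_angleD[OF a, of q 1] \<open>0 < q\<close> \<open>q < 1\<close> g01
      by (simp_all add: u_def)
    then show "sgn (1 - g q) = u" "cmod u = 1"
      using q(2) norm_cis[of "a (0, q)"] by simp_all
  qed
  have "z = of_real (cmod z) * sgn z" for z :: complex
    by (cases "z = 0") (simp_all add: sgn_eq)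
  then have eq: "g q = of_real (cmod (g q)) * u" "1 - g q = of_real (cmod (1 - g q)) * u"
    using u(1) by (metis u_def)+
  then have "1 = of_real (cmod (g q) + cmod (1 - g q)) * u"
    by (metis (no_types, lifting) add.commute diff_add_cancel distrib_right of_real_add)
  moreover from this have "cmod (g q) + cmod (1 - g q) = 1"
    using u(2) by (metis (no_types, lifting) abs_of_nonneg add_nonneg_nonneg mult.right_neutral norm_ge_zero norm_mult norm_of_real norm_one)
  ultimately have "u = 1" by simp
  have "cmod (g q) \<noteq> 0" "cmod (1 - g q) \<noteq> 0"
    using u \<open>u = 1\<close> by (auto simp: u_def)
  then show False
    using chord_crossing_absurd[OF g a g01 a01 shortest, of q "cmod (g q)"] q(1) eq(1) \<open>u = 1\<close>
      \<open>cmod (g q) + cmod (1 - g q) = 1\<close> by (smt (verit) atLeastAtMost_iff mult.right_neutral norm_ge_zero)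
qed

lemma chord_angle_attained_on_diagonal:
  assumes g: "path g" and a: "chord_angle g a"
  obtains s where "s \<in> {0..1}" "a (s, s) = a (0, 1)"
proof -
  define T where "T = {(s, r). 0 \<le> s \<and> s \<le> r \<and> r \<le> (1::real)}"
  define L where "L = T \<inter> a -` {a (0, 1)}"
  have T_eq: "T = ({0..1} \<times> {0..1}) \<inter> {p. fst p \<le> snd p}"
    by (auto simp: T_def)
  have "compact T"
    unfolding T_eq by (intro compact_Int_closed compact_Times closed_Collect_le continuous_intros) auto
  moreover have "closed L"
    unfolding L_def
  proof (rule continuous_closed_preimage)
    show "continuous_on T a"
      using a by (simp add: chord_angle_def T_def)
  qed (use \<open>compact T\<close> in \<open>simp_all add: compact_imp_closed\<close>)
  moreover have "L = T \<inter> L"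
    by (auto simp: L_def)
  ultimately have "compact L"
    by (metis compact_Int_closed)
  moreover have "(0, 1) \<in> L"
    by (auto simp: L_def T_def)
  moreover have "continuous_on L (\<lambda>p. cmod (g (snd p) - g (fst p)))"
    by (intro continuous_intros continuous_on_compose2[OF g[unfolded path_def]]) (auto simp: L_def T_def)
  ultimately have "\<exists>p\<in>L. \<forall>p'\<in>L. cmod (g (snd p) - g (fst p)) \<le> cmod (g (snd p') - g (fst p'))"
    by (intro continuous_attains_inf) auto
  then obtain p where "p \<in> L"
    and p: "\<forall>p'\<in>L. cmod (g (snd p) - g (fst p)) \<le> cmod (g (snd p') - g (fst p'))"
    by blast
  define u v where "u = fst p" and "v = snd p"
  have uv: "0 \<le> u" "u \<le> v" "v \<le> 1" "a (u, v) = a (0, 1)"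
    using \<open>p \<in> L\<close> by (auto simp: L_def T_def u_def v_def)
  have min: "cmod (g v - g u) \<le> cmod (g r - g s)"
    if "0 \<le> s" "s \<le> r" "r \<le> 1" "a (s, r) = a (0, 1)" for s r
    using bspec[OF p, of "(s, r)"] that by (simp add: L_def T_def u_def v_def)
  show thesis
  proof (cases "u = v")
    case True
    then show ?thesis using that uv by auto
  next
    case False
    then have "u < v" using uv by simp
    then have ne: "g u \<noteq> g v"
      using inj_onD[OF chord_angle_inj_on[OF a], of u v] uv by auto
    \<comment> \<open>After rescaling, minimality says that every chord of angle 0 has length at
      least 1.\<close>
    define h where "h t = (g (u + t * (v - u)) - g u) / (g v - g u)" for t
    define b where "b = (\<lambda>(s, r). a (u + s * (v - u), u + r * (v - u)) - a (u, v))"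
    have *: "0 \<le> u + t * (v - u) \<and> u + t * (v - u) \<le> 1" if "0 \<le> t" "t \<le> 1" for t
      using affine_in_unit_interval[of u v t] that uv by simp
    have "chord_angle h b"
      using chord_angle_subarc[OF a uv(1) \<open>u < v\<close> uv(3)] unfolding h_def b_def .
    moreover have "path h"
      unfolding h_def path_def using ne *
      by (intro continuous_intros continuous_on_compose2[OF g[unfolded path_def]]) auto
    moreover have "1 \<le> cmod (h r - h s)" if sr: "0 \<le> s" "s \<le> r" "r \<le> 1" "b (s, r) = 0" for s r
    proof -
      have "h r - h s = (g (u + r * (v - u)) - g (u + s * (v - u))) / (g v - g u)"
        by (simp add: h_def flip: diff_divide_distrib)
      moreover have "cmod (g v - g u) \<le> cmod (g (u + r * (v - u)) - g (u + s * (v - u)))"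
        using sr uv *[of s] *[of r] by (intro min) (auto simp: b_def intro: mult_right_mono)
      ultimately show ?thesis
        using ne by (simp add: norm_divide)
    qed
    ultimately obtain s where "s \<in> {0..1}" "b (s, s) = 0"
      using shortest_chord_angle_attained[of h b] ne by (auto simp: h_def b_def)
    then show ?thesis
      using that[of "u + s * (v - u)"] *[of s] uv by (auto simp: b_def)
  qed
qed

subsection \<open>The arcs swept by an isotopy\<close>

definition to_complex :: "plane \<Rightarrow> complex" where
  "to_complex v = Complex (v $ 1) (v $ 2)"

lemma bounded_linear_to_complex: "bounded_linear to_complex"
  unfolding linear_conv_bounded_linear[symmetric]
  by (rule linearI) (simp_all add: to_complex_def complex_eq_iff)

lemmas to_complex_diff = linear_diff[OF bounded_linear.linear[OF bounded_linear_to_complex]]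

lemma to_complex_eq_0_iff [simp]: "to_complex v = 0 \<longleftrightarrow> v = 0"
  by (simp add: to_complex_def complex_eq_iff vec_eq_iff forall_2)

lemma cmod_to_complex: "cmod (to_complex v) = norm v"
  by (simp add: to_complex_def norm_vec_def L2_set_def sum_2 cmod_def)

lemma oriented_angle_eq_proj_circle:
  assumes "sgn (to_complex v) = cis a"
  shows "oriented_angle (vector [1, 0]) v = proj_circle a"
proof -
  have e: "norm (vector [1, 0] :: plane) = 1"
    by (simp add: norm_vec_def L2_set_def sum_2)
  have "v \<noteq> 0"
    using assms by (metis cis_neq_zero sgn_0 to_complex_eq_0_iff)
  moreover have "Re (sgn (to_complex v)) = v $ 1 / norm v" "Im (sgn (to_complex v)) = v $ 2 / norm v"
    by (simp_all add: cmod_to_complex) (simp_all add: to_complex_def)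
  then have "has_oriented_angle (vector [1, 0]) v a"
    unfolding has_oriented_angle_def rotation_def e assms
    by (simp add: vec_eq_iff forall_2 divide_inverse_commute)
  moreover have "vector [1, 0] \<noteq> (0 :: plane)"
    using e by force
  ultimately show ?thesis
    by (simp add: oriented_angle_eq_iff)
qed

text \<open>Both \<open>Torsion1\<close> and \<open>Linking1\<close> are computed through this from
  an explicit lift \<open>\<phi>\<close>.\<close>

lemma angle_variation_oriented_angle:
  assumes "continuous_on {0..1} \<phi>" "\<And>t. t \<in> {0..1} \<Longrightarrow> sgn (to_complex (v t)) = cis (\<phi> t)"
  shows "angle_variation (\<lambda>t. oriented_angle (vector [1, 0]) (v t)) = \<phi> 1 - \<phi> 0"
  using assms by (intro angle_variation_eq)
    (auto simp: continuous_determination_def oriented_angle_eq_proj_circle)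

section \<open>Derivatives of the maps of an isotopy\<close>

lemma C1_map_has_derivative:
  "C1_map f \<Longrightarrow> (f has_derivative (\<lambda>h. jacobian f (at z) *v h)) (at z)"
  by (simp add: C1_map_def flip: jacobian_works)

text \<open>The chain rule for \<open>inv f (f w) = w\<close> gives the Jacobian matrix a left
  inverse.\<close>

lemma Diff1_jacobian_nonzero:
  assumes "f \<in> Diff1" "h \<noteq> 0"
  shows "jacobian f (at z) *v h \<noteq> 0"
proof -
  have f: "bij f" "C1_map f" "C1_map (inv f)"
    using assms by (simp_all add: Diff1_def)
  have "((\<lambda>w. inv f (f w)) has_derivative
      (\<lambda>h. jacobian (inv f) (at (f z)) *v (jacobian f (at z) *v h))) (at z)"
    using C1_map_has_derivative[OF f(2)] C1_map_has_derivative[OF f(3)]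
    by (rule has_derivative_compose)
  moreover have "(\<lambda>w. inv f (f w)) = (\<lambda>w. w)"
    using f(1) by (simp add: bij_is_inj)
  ultimately have "(\<lambda>h. jacobian (inv f) (at (f z)) *v (jacobian f (at z) *v h)) = (\<lambda>h. h)"
    using has_derivative_unique has_derivative_ident by metis
  then show ?thesis
    using assms(2) by (metis matrix_vector_mult_0_right)
qed

lemma pathin_weak_C1_Diff1:
  assumes "pathin weak_C1_topology F" "t \<in> {0..1}"
  shows "F t \<in> Diff1"
  using assms continuous_map_image_subset_topspace[of "top_of_set {0..1}" weak_C1_topology F]
  by (auto simp: pathin_def topspace_weak_C1_topology)

text \<open>Uniform control of derivatives on compact sets as time varies combines with continuity
  in \<open>z\<close> at a fixed time.\<close>

lemma pathin_weak_C1_jacobian_continuous: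
  assumes F: "pathin weak_C1_topology F"
  shows "continuous_on ({0..1} \<times> UNIV) (\<lambda>(t, z). jacobian (F t) (at z))"
  unfolding continuous_on_iff
proof (clarify, goal_cases)
  case (1 t0 z0 e)
  have F0: "F t0 \<in> Diff1"
    using pathin_weak_C1_Diff1[OF F] 1 by simp
  \<comment> \<open>The unit ball serves as a compact neighbourhood of \<open>z0\<close>; half of
    \<open>e\<close> pays for the change of time, half for the change of point.\<close>
  define N where "N = C1_nbhd (F t0) (cball z0 1) (e / 2)"
  have "openin weak_C1_topology N"
    unfolding weak_C1_topology_def N_def using F0 1
    by (intro topology_generated_by_Basis) (auto intro!: exI[of _ "F t0"] exI[of _ "cball z0 1"] exI[of _ "e / 2"])
  then have "openin (top_of_set {0..1}) {t \<in> {0..1}. F t \<in> N}"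
    using F unfolding pathin_def by (auto dest!: openin_continuous_map_preimage)
  moreover have "t0 \<in> {t \<in> {0..1}. F t \<in> N}"
    using F0 1 by (simp add: N_def C1_nbhd_def)
  ultimately obtain d where d: "d > 0" "\<And>t. t \<in> {0..1} \<Longrightarrow> dist t t0 < d \<Longrightarrow> F t \<in> N"
    unfolding openin_euclidean_subtopology_iff by (metis (no_types, lifting) mem_Collect_eq)
  have "continuous_on UNIV (\<lambda>z. jacobian (F t0) (at z))"
    using F0 by (simp add: Diff1_def C1_map_def)
  then obtain d' where d': "d' > 0"
    "\<And>z. dist z z0 < d' \<Longrightarrow> dist (jacobian (F t0) (at z)) (jacobian (F t0) (at z0)) < e / 2"
    unfolding continuous_on_iff using 1 by (metis UNIV_I half_gt_zero)
  show ?case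
  proof (intro exI[of _ "min 1 (min d d')"] conjI allI impI ballI, use d d' in simp, clarify)
    fix t z assume t: "t \<in> {0..1}" and near: "dist (t, z) (t0, z0) < min 1 (min d d')"
    have "dist t t0 < d" "dist z z0 < d'" "dist z0 z \<le> 1"
      using near dist_fst_le[of "(t, z)" "(t0, z0)"] dist_snd_le[of "(t, z)" "(t0, z0)"]
      by (auto simp: dist_commute)
    then have "dist (jacobian (F t) (at z)) (jacobian (F t0) (at z)) < e / 2"
      "dist (jacobian (F t0) (at z)) (jacobian (F t0) (at z0)) < e / 2"
      using d(2)[OF t] d'(2) by (auto simp: N_def C1_nbhd_def)
    then show "dist (jacobian (F t) (at z)) (jacobian (F t0) (at z0)) < e"
      using dist_triangle[of "jacobian (F t) (at z)" "jacobian (F t0) (at z0)" "jacobian (F t0) (at z)"]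
      by linarith
  qed
qed

text \<open>Convexity makes the domain of the chord directions contractible, so that a continuous
  logarithm exists on it.\<close>

lemma convex_ordered_pairs: "convex {(s, r). 0 \<le> s \<and> s \<le> r \<and> r \<le> (1::real)}"
proof -
  have eq: "{(s, r). 0 \<le> s \<and> s \<le> r \<and> r \<le> (1::real)} = ({0..1} \<times> {0..1}) \<inter> {p. inner (1, - 1) p \<le> 0}"
    by (auto simp: inner_Pair)
  show ?thesis
    unfolding eq by (intro convex_Int convex_Times convex_halfspace_le) auto
qed

section \<open>Torsion and linking read off from one angle function\<close>

theorem theorem1p1:
  fixes F :: "real \<Rightarrow> plane \<Rightarrow> plane" and f :: "plane \<Rightarrow> plane"
    and x y :: plane and l :: real
  assumes "isotopy_joining F id f"
    and "x \<noteq> y"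
    and "Linking1 F x y = l"
  shows "\<exists>z \<in> closed_segment x y. Torsion1 F z (y - x) = l"
proof -
  have F: "pathin weak_C1_topology F" and F0: "F 0 = id"
    using assms(1) by (auto simp: isotopy_joining_def)
  note Diff = pathin_weak_C1_Diff1[OF F]
  have deriv: "(F t has_derivative (\<lambda>h. jacobian (F t) (at z) *v h)) (at z)" if "t \<in> {0..1}" for t z
    using Diff[OF that] by (simp add: Diff1_def C1_map_has_derivative)
  define P where "P s = x + s *\<^sub>R (y - x)" for s :: real
  define V where "V t s = to_complex (jacobian (F t) (at (P s)) *v (y - x))" for t s
  define \<Delta> where "\<Delta> = {(s, r). 0 \<le> s \<and> s \<le> r \<and> r \<le> (1::real)}"
  \<comment> \<open>The averaged derivative between \<open>P s\<close> and \<open>P r\<close> is the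
    difference quotient for \<open>s \<noteq> r\<close> and the tangent vector for
    \<open>s = r\<close>, so continuity at the diagonal comes from that of an integral with
    parameters.\<close>
  define H where "H = (\<lambda>(t, s, r). integral (cbox 0 1) (\<lambda>u. V t (s + u * (r - s))))"

  have V_cont: "continuous_on ({0..1} \<times> UNIV) (\<lambda>(t, s). V t s)"
  proof -
    have "continuous_on ({0..1} \<times> UNIV) (\<lambda>p. case (fst p, P (snd p)) of (t, z) \<Rightarrow> jacobian (F t) (at z))"
      unfolding P_def
      by (rule continuous_on_compose2[OF pathin_weak_C1_jacobian_continuous[OF F]])
        (auto intro!: continuous_intros)
    then show ?thesis
      unfolding V_def matrix_vector_mult_def case_prod_unfold
      by (intro bounded_linear.continuous_on[OF bounded_linear_to_complex] continuous_intros) auto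
  qed
  have V_cont': "continuous_on S (\<lambda>p. V (v p) (w p))"
    if "continuous_on S v" "continuous_on S w" "v ` S \<subseteq> {0..1}" for S and v w :: "'a::topological_space \<Rightarrow> real"
    using continuous_on_compose2[OF V_cont, of S "\<lambda>p. (v p, w p)"] that
    by (auto intro!: continuous_intros)
  have H_chord: "of_real (r - s) * H (t, s, r) = to_complex (F t (P r) - F t (P s))"
    if t: "t \<in> {0..1}" for t s r
  proof -
    have "((\<lambda>u. to_complex (F t (P (s + u * (r - s))))) has_vector_derivative
        (r - s) *\<^sub>R V t (s + u * (r - s))) (at u within {0..1})" for u
    proof -
      have "((\<lambda>u. P (s + u * (r - s))) has_derivative (\<lambda>h. (h * (r - s)) *\<^sub>R (y - x))) (at u within {0..1})"
        unfolding P_def by (auto intro!: derivative_eq_intros)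
      from has_derivative_compose[OF has_derivative_compose[OF this deriv[OF t]]
          bounded_linear.has_derivative[OF bounded_linear_to_complex has_derivative_ident]]
      show ?thesis
        by (simp add: has_vector_derivative_def V_def matrix_vector_mult_scaleR
            linear_cmul[OF bounded_linear.linear[OF bounded_linear_to_complex]] mult.commute)
    qed
    then have "((\<lambda>u. (r - s) *\<^sub>R V t (s + u * (r - s))) has_integral
        to_complex (F t (P (s + 1 * (r - s)))) - to_complex (F t (P (s + 0 * (r - s))))) {0..1}"
      by (intro fundamental_theorem_of_calculus) auto
    from integral_unique[OF this] show ?thesis
      by (simp add: H_def scaleR_conv_of_real to_complex_diff)
  qed
  have H_diag: "H (t, s, s) = V t s" for t s
    by (simp add: H_def)
  \<comment> \<open>On the diagonal the invertible derivative is used, off it the injectivity of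
    \<open>F t\<close>.\<close>
  have H_ne: "H p \<noteq> 0" if memp: "p \<in> {0..1} \<times> \<Delta>" for p
  proof -
    obtain t s r where p: "p = (t, s, r)" "t \<in> {0..1}" "s \<le> r"
      using memp by (auto simp: \<Delta>_def)
    show ?thesis
    proof (cases "s = r")
      case True
      then show ?thesis
        using Diff1_jacobian_nonzero[OF Diff[OF p(2)]] assms(2) by (simp add: p(1) H_diag V_def)
    next
      case False
      then have "P r \<noteq> P s"
        using assms(2) by (simp add: P_def)
      moreover have "inj (F t)"
        using Diff[OF p(2)] by (simp add: Diff1_def bij_is_inj)
      ultimately have "to_complex (F t (P r) - F t (P s)) \<noteq> 0"
        by (simp add: inj_eq)
      then show ?thesis
        using H_chord[OF p(2), of r s] by (auto simp: p(1))
    qed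
  qed
  have "continuous_on ({0..1} \<times> \<Delta>) (\<lambda>p. integral (cbox 0 1) (\<lambda>u. V (fst p) (fst (snd p) + u * (snd (snd p) - fst (snd p)))))"
    unfolding case_prod_unfold
    by (rule integral_continuous_on_param) (auto intro!: V_cont' continuous_intros simp: case_prod_unfold)
  then have "continuous_on ({0..1} \<times> \<Delta>) H"
    by (simp add: H_def case_prod_unfold)
  moreover have "contractible ({0..1::real} \<times> \<Delta>)"
    unfolding \<Delta>_def by (intro convex_imp_contractible convex_Times convex_ordered_pairs) auto
  \<comment> \<open>One logarithm serves all times, chords and tangents at once; its imaginary part
    \<open>A\<close> is the common angle function.\<close>
  ultimately obtain L where L: "continuous_on ({0..1} \<times> \<Delta>) L"
    and HL: "\<And>p. p \<in> {0..1} \<times> \<Delta> \<Longrightarrow> H p = exp (L p)"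
    using H_ne continuous_logarithm_on_contractible by metis
  define A where "A p = Im (L p)" for p
  have A_cont: "continuous_on S (\<lambda>q. A (v q))" if "continuous_on S v" "v ` S \<subseteq> {0..1} \<times> \<Delta>"
    for S and v :: "'b::topological_space \<Rightarrow> real \<times> real \<times> real"
    unfolding A_def by (intro continuous_on_Im continuous_on_compose2[OF L] that)
  have A: "cis (A p) = sgn (H p)" if "p \<in> {0..1} \<times> \<Delta>" for p
    using HL[OF that] by (simp add: A_def sgn_exp_complex)
  have A_chord: "cis (A (t, s, r)) = sgn (to_complex (F t (P r) - F t (P s)))"
    if "t \<in> {0..1}" "0 \<le> s" "s < r" "r \<le> 1" for t s r
  proof -
    have "sgn (of_real (r - s) * H (t, s, r)) = sgn (H (t, s, r))"
      using that by (simp only: sgn_mult sgn_of_real) simp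
    then show ?thesis
      using A[of "(t, s, r)"] H_chord[of t r s] that by (simp add: \<Delta>_def)
  qed

  define g where "g s = to_complex (F 1 (P s))" for s
  have "continuous_on UNIV (F 1)"
    using has_derivative_continuous[OF deriv[of 1]] by (simp add: continuous_on_eq_continuous_at)
  then have "continuous_on {0..1} (\<lambda>s. F 1 (P s))"
    unfolding P_def by (rule continuous_on_compose2) (auto intro!: continuous_intros)
  then have "path g"
    unfolding path_def g_def by (rule bounded_linear.continuous_on[OF bounded_linear_to_complex])
  moreover have "chord_angle g (\<lambda>p. A (1, p))"
    unfolding chord_angle_def g_def using A_chord[of 1]
    by (auto simp: to_complex_diff \<Delta>_def intro!: A_cont continuous_intros)
  ultimately obtain s where s: "s \<in> {0..1}" "A (1, s, s) = A (1, 0, 1)"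
    using chord_angle_attained_on_diagonal by metis

  \<comment> \<open>At time 0 all chords and tangents have the direction of \<open>y - x\<close>, so
    \<open>A (0, p)\<close> lifts a constant on the connected set \<open>\<Delta>\<close>.\<close>
  have "A (0, s, s) = A (0, 0, 1)"
  proof -
    have "jacobian id (at z) *v h = h" for z h :: plane
    proof -
      have "(id has_derivative (\<lambda>h. jacobian id (at z) *v h)) (at z)"
        using deriv[of 0 z] by (simp add: F0)
      from has_derivative_unique[OF this has_derivative_id] show ?thesis
        by (simp add: fun_eq_iff)
    qed
    then have H0: "H (0, p) = to_complex (y - x)" for p
      by (cases p) (simp add: H_def V_def F0)
    have conn: "connected \<Delta>"
      unfolding \<Delta>_def by (intro convex_connected convex_ordered_pairs)
    have mem: "(0, 1) \<in> \<Delta>" "(s, s) \<in> \<Delta>"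
      using s by (auto simp: \<Delta>_def)
    have cont: "continuous_on \<Delta> (\<lambda>p. A (0, p))"
      by (intro A_cont continuous_intros) auto
    have "cis (A (0, p)) = cis (A (0, 0, 1))" if "p \<in> \<Delta>" for p
      using A[of "(0, p)"] A[of "(0, 0, 1)"] that mem by (simp add: H0)
    then obtain c where "\<And>p. p \<in> \<Delta> \<Longrightarrow> A (0, p) = A (0, 0, 1) + c"
      using cis_lifts_differ_by_constant[OF conn cont continuous_on_const] by blast
    from this[OF mem(1)] this[OF mem(2)] show ?thesis by simp
  qed
  \<comment> \<open>The two variations agree because \<open>A (t, s, s)\<close> and
    \<open>A (t, 0, 1)\<close> coincide both at t = 0 and at t = 1.\<close>
  moreover have "Torsion1 F (P s) (y - x) = A (1, s, s) - A (0, s, s)"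
    unfolding Torsion1_def
  proof (rule angle_variation_oriented_angle)
    show "continuous_on {0..1} (\<lambda>t. A (t, s, s))"
      by (intro A_cont continuous_intros) (use s in \<open>auto simp: \<Delta>_def\<close>)
    show "sgn (to_complex (frechet_derivative (F t) (at (P s)) (y - x))) = cis (A (t, s, s))"
      if "t \<in> {0..1}" for t
      unfolding frechet_derivative_at[OF deriv[OF that, of "P s"], symmetric]
      using A[of "(t, s, s)"] that s by (simp add: H_diag V_def \<Delta>_def)
  qed
  moreover have "Linking1 F x y = A (1, 0, 1) - A (0, 0, 1)"
    unfolding Linking1_def
  proof (rule angle_variation_oriented_angle)
    show "continuous_on {0..1} (\<lambda>t. A (t, 0, 1))"
      by (intro A_cont continuous_intros) (auto simp: \<Delta>_def)
    show "sgn (to_complex (F t y - F t x)) = cis (A (t, 0, 1))" if "t \<in> {0..1}" for t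
      using A_chord[of t 0 1] that by (simp add: P_def)
  qed
  moreover have "P s \<in> closed_segment x y"
    using s unfolding P_def closed_segment_def by (auto intro!: exI[of _ s] simp: algebra_simps)
  ultimately show ?thesis
    using s assms(3) by (intro bexI[of _ "P s"]) simp_all
qed

end
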